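(* Let $\Omega$ and $\Theta$ be nonempty convex sets in normed vector spaces $X$ and $Y$, respectively, let $\sigma\ge 0$ and $1\le p\le\infty$, and equip $X\times Y$ with the $p$-norm. Assume that $f\colon\Omega\times\Theta\to[-\infty,\infty]$ is $\sigma$-quasiconvex, and $F\colon\Omega\rightrightarrows\Theta$ is a convex set-valued map. Then the optimal value function $$v(x)=\inf_{y\in F(x)}f(x,y),\quad x\in\Omega,$$ is $\sigma$-quasiconvex on $\Omega$.
   Context: All normed vector spaces are real and nontrivial. Convention: $\inf\emptyset=\infty$. The $p$-norm on $X\times Y$ is $\|(x,y)\|=(\|x\|^p+\|y\|^p)^{1/p}$ for $p<\infty$ and $\|(x,y)\|=\max\{\|x\|,\|y\|\}$ for $p=\infty$. Let $\sigma\ge 0$. A function $g\colon C\to[-\infty,\infty]$ on a nonempty convex subset $C$ of a normed vector space is $\sigma$-quasiconvex if $g(\lambda x+(1-\lambda)y)\le\max\{g(x),g(y)\}-\frac{\sigma}{2}\lambda(1-\lambda)\|x-y\|^2$ for all $x,y\in C$ and $0<\lambda<1$. A set-valued map $F\colon\Omega\rightrightarrows\Theta$ assigns to each $x\in\Omega$ a (possibly empty) subset $F(x)\subset\Theta$; it is convex if its graph $\{(x,y)\in\Omega\times\Theta\mid y\in F(x)\}$ is a convex subset of $X\times Y$. *)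

theory Defs
  imports "HOL-Analysis.Analysis"
begin

(* The library's norm on a product type is the 2-norm only, so the product norm for general
   p is a separate function and quasiconvexity takes the norm as a parameter. *)

definition p_norm :: "ereal \<Rightarrow> 'a::real_normed_vector \<times> 'b::real_normed_vector \<Rightarrow> real" where
  "p_norm p z =
     (if p = \<infinity> then max (norm (fst z)) (norm (snd z))
      else (norm (fst z) powr real_of_ereal p + norm (snd z) powr real_of_ereal p)
             powr (1 / real_of_ereal p))"

definition quasiconvex_wrt ::
    "('v::real_vector \<Rightarrow> real) \<Rightarrow> real \<Rightarrow> 'v set \<Rightarrow> ('v \<Rightarrow> ereal) \<Rightarrow> bool" where
  "quasiconvex_wrt N \<sigma> C g \<longleftrightarrow>
     C \<noteq> {} \<and> convex C \<and>
     (\<forall>x\<in>C. \<forall>y\<in>C. \<forall>t::real. 0 < t \<and> t < 1 \<longrightarrow>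
        g (t *\<^sub>R x + (1 - t) *\<^sub>R y)
          \<le> max (g x) (g y) - ereal (\<sigma> / 2 * t * (1 - t) * (N (x - y))\<^sup>2))"

definition set_valued_map :: "'a set \<Rightarrow> 'b set \<Rightarrow> ('a \<Rightarrow> 'b set) \<Rightarrow> bool" where
  "set_valued_map \<Omega> \<Theta> F \<longleftrightarrow> (\<forall>x\<in>\<Omega>. F x \<subseteq> \<Theta>)"

definition convex_set_valued_map ::
    "'a::real_vector set \<Rightarrow> 'b::real_vector set \<Rightarrow> ('a \<Rightarrow> 'b set) \<Rightarrow> bool" where
  "convex_set_valued_map \<Omega> \<Theta> F \<longleftrightarrow>
     set_valued_map \<Omega> \<Theta> F \<and> convex {(x, y). x \<in> \<Omega> \<and> y \<in> \<Theta> \<and> y \<in> F x}"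

(* In ereal the infimum over the empty set is \<infinity>. *)
definition optimal_value :: "('a \<Rightarrow> 'b set) \<Rightarrow> ('a \<times> 'b \<Rightarrow> ereal) \<Rightarrow> 'a \<Rightarrow> ereal" where
  "optimal_value F f x = (INF y\<in>F x. f (x, y))"

end

theory Submission
  imports Defs
begin

text \<open>Choose values \<open>u\<close> over \<open>x\<close> and \<open>w\<close> over
  \<open>y\<close>. Convexity of the graph makes the combination of \<open>u\<close> and
  \<open>w\<close> an admissible competitor at the combined point, so quasiconvexity of
  \<open>f\<close> bounds the optimal value there. The quadratic term involves the product norm of
  \<open>(x, u) - (y, w)\<close>; by \<open>norm_fst_le_p_norm\<close> it only shrinks when that is
  replaced by \<open>norm (x - y)\<close>, which no longer depends on \<open>u\<close> and
  \<open>w\<close>. The infima over \<open>u\<close> and \<open>w\<close> can then be taken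
  independently.\<close>

lemma norm_fst_le_p_norm:
  assumes "1 \<le> p"
  shows "norm (fst z) \<le> p_norm p z"
proof (cases "p = \<infinity>")
  case True
  then show ?thesis
    by (simp add: p_norm_def)
next
  case False
  define r where "r = real_of_ereal p"
  have r: "1 \<le> r"
    using assms False by (cases p) (auto simp: r_def)
  \<comment> \<open>Dropping the nonnegative second summand under the monotone \<open>r\<close>-th
    root gives the bound.\<close>
  have "norm (fst z) = (norm (fst z) powr r) powr (1 / r)"
    using r by (simp add: powr_powr)
  also have "\<dots> \<le> (norm (fst z) powr r + norm (snd z) powr r) powr (1 / r)"
    using r by (intro powr_mono2) auto
  finally show ?thesis
    using False by (simp add: p_norm_def r_def)
qed

theorem proposition2p11:
  fixes \<Omega> :: "'a::real_normed_vector set"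
    and \<Theta> :: "'b::real_normed_vector set"
    and \<sigma> :: real
    and p :: ereal
    and f :: "'a \<times> 'b \<Rightarrow> ereal"
    and F :: "'a \<Rightarrow> 'b set"
  assumes "\<exists>x::'a. x \<noteq> 0" and "\<exists>y::'b. y \<noteq> 0"
    and "\<Omega> \<noteq> {}" and "convex \<Omega>"
    and "\<Theta> \<noteq> {}" and "convex \<Theta>"
    and "0 \<le> \<sigma>" and "1 \<le> p"
    and "quasiconvex_wrt (p_norm p) \<sigma> (\<Omega> \<times> \<Theta>) f"
    and "convex_set_valued_map \<Omega> \<Theta> F"
  shows "quasiconvex_wrt norm \<sigma> \<Omega> (optimal_value F f)"
proof -
  have "optimal_value F f (t *\<^sub>R x + (1 - t) *\<^sub>R y)
          \<le> max (optimal_value F f x) (optimal_value F f y)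
            - ereal (\<sigma> / 2 * t * (1 - t) * (norm (x - y))\<^sup>2)"
    if xy: "x \<in> \<Omega>" "y \<in> \<Omega>" and t: "0 < t" "t < 1" for x y t
  proof -
    let ?z = "t *\<^sub>R x + (1 - t) *\<^sub>R y"
    let ?c = "\<sigma> / 2 * t * (1 - t) * (norm (x - y))\<^sup>2"
    \<comment> \<open>The quadratic term is a finite real, so it can be moved to the left even where
      \<open>f\<close> is infinite; the left side is then free of \<open>u\<close> and
      \<open>w\<close>.\<close>
    have le: "optimal_value F f ?z + ereal ?c \<le> max (f (x, u)) (f (y, w))"
      if u: "u \<in> F x" and w: "w \<in> F y" for u w
    proof -
      let ?q = "t *\<^sub>R u + (1 - t) *\<^sub>R w"
      let ?C = "\<sigma> / 2 * t * (1 - t) * (p_norm p ((x, u) - (y, w)))\<^sup>2"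
      have \<Theta>: "u \<in> \<Theta>" "w \<in> \<Theta>"
        using assms(10) xy u w by (auto simp: convex_set_valued_map_def set_valued_map_def)
      \<comment> \<open>This gives \<open>?q \<in> F ?z\<close>, so \<open>f (?z, ?q)\<close> is one
        of the values in the infimum at \<open>?z\<close>.\<close>
      have "t *\<^sub>R (x, u) + (1 - t) *\<^sub>R (y, w) \<in> {(x, y). x \<in> \<Omega> \<and> y \<in> \<Theta> \<and> y \<in> F x}"
        using assms(10) xy \<Theta> u w t
        by (intro convexD) (auto simp: convex_set_valued_map_def)
      then have "optimal_value F f ?z \<le> f (?z, ?q)"
        by (auto simp: optimal_value_def intro: INF_lower)
      also have "f (?z, ?q) \<le> max (f (x, u)) (f (y, w)) - ereal ?C"
        using assms(9) xy \<Theta> t unfolding quasiconvex_wrt_def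
        by (metis SigmaI add_Pair scaleR_Pair)
      finally have "optimal_value F f ?z + ereal ?C \<le> max (f (x, u)) (f (y, w))"
        by (simp add: ereal_le_minus)
      moreover have "norm (x - y) \<le> p_norm p ((x, u) - (y, w))"
        using norm_fst_le_p_norm[OF assms(8), of "(x, u) - (y, w)"] by simp
      then have "?c \<le> ?C"
        using assms(7) t by (intro mult_left_mono power_mono) auto
      ultimately show ?thesis
        by (meson add_left_mono ereal_less_eq(3) order_trans)
    qed
    have "optimal_value F f ?z + ereal ?c \<le> max (optimal_value F f x) (optimal_value F f y)"
    proof (rule ccontr)
      assume "\<not> ?thesis"
      \<comment> \<open>Both infima lie strictly below the left side, so each is beaten by an actual
        value. An empty \<open>F x\<close> or \<open>F y\<close> needs no separate case: its infimum
        \<infinity> is strictly below nothing.\<close>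
      then obtain u w where "u \<in> F x" "f (x, u) < optimal_value F f ?z + ereal ?c"
        and "w \<in> F y" "f (y, w) < optimal_value F f ?z + ereal ?c"
        unfolding not_le max_less_iff_conj
        by (auto simp: optimal_value_def[of F f x] optimal_value_def[of F f y] INF_less_iff)
      with le[of u w] show False
        by (auto simp: le_max_iff_disj)
    qed
    then show ?thesis
      by (simp add: ereal_le_minus)
  qed
  then show ?thesis
    using assms(3,4) by (auto simp: quasiconvex_wrt_def)
qed

end
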